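(* Let $(X,d)$ be a nonempty metric space, let $r\in[0,1]$ and let $U$ be a subset of $F^r_{USCG}(X)$. Then the following properties are equivalent. (i) $U$ is compact in $(F_{USCG}(X), H_{\rm end})$. (ii) $U$ is compact in $(F^r_{USCG}(X), H_{\rm end})$. (iii) $U(\alpha)$ is relatively compact in $(X,d)$ for each $\alpha\in(0,1]$ and $U$ is closed in $(F_{USCG}(X), H_{\rm end})$. (iv) $U(\alpha)$ is compact in $(X,d)$ for each $\alpha\in(0,1]$ and $U$ is closed in $(F_{USCG}(X), H_{\rm end})$. (v) $U(\alpha)$ is relatively compact in $(X,d)$ for each $\alpha\in(0,r]$ and $U$ is closed in $(F^r_{USCG}(X), H_{\rm end})$. (vi) $U(\alpha)$ is compact in $(X,d)$ for each $\alpha\in(0,r]$ and $U$ is closed in $(F^r_{USCG}(X), H_{\rm end})$.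
   Context: A fuzzy set in $X$ is a function $u:X\to[0,1]$. For $\alpha\in(0,1]$, $[u]_\alpha=\{x\in X: u(x)\ge\alpha\}$, and $[u]_0=\overline{\{x\in X: u(x)>0\}}$ (closure in $X$). $C(X)$ and $K(X)$ denote the sets of all nonempty closed, respectively nonempty compact, subsets of $X$. $F_{USC}(X)$ is the set of fuzzy sets $u$ in $X$ with $[u]_\alpha\in C(X)\cup\{\emptyset\}$ for all $\alpha\in[0,1]$ (the upper semicontinuous fuzzy sets), and $F_{USCG}(X)=\{u\in F_{USC}(X): [u]_\alpha\in K(X)\cup\{\emptyset\}\text{ for all }\alpha\in(0,1]\}$. For $r\in[0,1]$, $F^r_{USCG}(X)=\{u\in F_{USCG}(X): r=\max\{u(x):x\in X\}\}$ (the maximum is required to exist and equal $r$). $X\times[0,1]$ carries the metric $\overline d((x,\alpha),(y,\beta))=d(x,y)+|\alpha-\beta|$. The endograph of $u$ is ${\rm end}\,u=\{(x,t)\in X\times[0,1]: u(x)\ge t\}$; for $u\in F_{USC}(X)$ it is a nonempty closed set. For nonempty closed $A,B\subseteq X\times[0,1]$, $H(A,B)=\max\{\sup_{a\in A}\inf_{b\in B}\overline d(a,b),\ \sup_{b\in B}\inf_{a\in A}\overline d(a,b)\}$. The endograph metric on $F_{USC}(X)$ and its subsets is $H_{\rm end}(u,v)=H({\rm end}\,u,{\rm end}\,v)$. For a set $U$ of fuzzy sets, $U(\alpha)=\bigcup_{u\in U}[u]_\alpha$ (an empty union is $\emptyset$; the empty set counts as compact). A subset $A$ of a metric space $Z$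 is relatively compact in $Z$ if its closure in $Z$ is compact. Convention: $(0,0]=\emptyset$. *)

theory Defs
  imports "HOL-Analysis.Analysis"
begin

section \<open>Fuzzy sets in a metric space\<close>

definition fuzzy_set :: "('a \<Rightarrow> real) \<Rightarrow> bool" where
  "fuzzy_set u \<longleftrightarrow> (\<forall>x. u x \<in> {0..1})"

definition level :: "('a::metric_space \<Rightarrow> real) \<Rightarrow> real \<Rightarrow> 'a set" where
  "level u \<alpha> = (if \<alpha> = 0 then closure {x. u x > 0} else {x. u x \<ge> \<alpha>})"

text \<open>Level sets may be empty: since \<open>closed\<close> and \<open>compact\<close> hold of the empty set, they
  express membership in the nonempty closed (compact) sets together with the empty set.\<close>

definition F_USC :: "('a::metric_space \<Rightarrow> real) set" where
  "F_USC = {u. fuzzy_set u \<and> (\<forall>\<alpha>\<in>{0..1}. closed (level u \<alpha>))}"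

definition F_USCG :: "('a::metric_space \<Rightarrow> real) set" where
  "F_USCG = {u \<in> F_USC. \<forall>\<alpha>\<in>{0<..1}. compact (level u \<alpha>)}"

definition F_USCG_max :: "real \<Rightarrow> ('a::metric_space \<Rightarrow> real) set" where
  "F_USCG_max r = {u \<in> F_USCG. (\<exists>x. u x = r) \<and> (\<forall>x. u x \<le> r)}"

definition level_union :: "('a::metric_space \<Rightarrow> real) set \<Rightarrow> real \<Rightarrow> 'a set" where
  "level_union U \<alpha> = (\<Union>u\<in>U. level u \<alpha>)"

definition relatively_compact :: "'a::topological_space set \<Rightarrow> bool" where
  "relatively_compact S \<longleftrightarrow> compact (closure S)"


section \<open>The endograph metric\<close>

definition endograph :: "('a \<Rightarrow> real) \<Rightarrow> ('a \<times> real) set" where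
  "endograph u = {(x, t). t \<in> {0..1} \<and> u x \<ge> t}"

text \<open>The sum metric, not the Euclidean one that the library puts on product types.\<close>

definition sum_dist :: "'a::metric_space \<times> real \<Rightarrow> 'a \<times> real \<Rightarrow> real" where
  "sum_dist p q = dist (fst p) (fst q) + \<bar>snd p - snd q\<bar>"

definition hausdorff_excess ::
    "('a::metric_space \<times> real) set \<Rightarrow> ('a \<times> real) set \<Rightarrow> ennreal" where
  "hausdorff_excess A B = (SUP a\<in>A. INF b\<in>B. ennreal (sum_dist a b))"

text \<open>The Hausdorff distance of two sets may be infinite, so it is taken in \<open>ennreal\<close>.
  On endographs of fuzzy sets it is at most 1 (\<open>hausdorff_endograph_le\<close>),
  so that the conversion to \<open>real\<close> in \<open>H_end\<close> loses nothing.\<close>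

definition hausdorff ::
    "('a::metric_space \<times> real) set \<Rightarrow> ('a \<times> real) set \<Rightarrow> ennreal" where
  "hausdorff A B = max (hausdorff_excess A B) (hausdorff_excess B A)"

definition H_end :: "('a::metric_space \<Rightarrow> real) \<Rightarrow> ('a \<Rightarrow> real) \<Rightarrow> real" where
  "H_end u v = enn2real (hausdorff (endograph u) (endograph v))"


section \<open>\<open>H_end\<close> is a metric\<close>

lemma sum_dist_nonneg [simp]: "0 \<le> sum_dist p q"
  by (simp add: sum_dist_def)

lemma sum_dist_commute: "sum_dist p q = sum_dist q p"
  by (simp add: sum_dist_def dist_commute abs_minus_commute)

lemma sum_dist_self [simp]: "sum_dist p p = 0"
  by (simp add: sum_dist_def)

lemma sum_dist_triangle: "sum_dist p s \<le> sum_dist p q + sum_dist q s"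
  using dist_triangle[of "fst p" "fst s" "fst q"] by (simp add: sum_dist_def)

lemma hausdorff_commute: "hausdorff A B = hausdorff B A"
  by (simp add: hausdorff_def max.commute)

lemma hausdorff_self [simp]: "hausdorff A A = 0"
proof -
  have "(INF b\<in>A. ennreal (sum_dist a b)) \<le> 0" if "a \<in> A" for a
    by (rule INF_lower2[OF that]) simp
  then have "hausdorff_excess A A \<le> 0"
    unfolding hausdorff_excess_def by (intro SUP_least) auto
  then show ?thesis by (simp add: hausdorff_def)
qed

lemma le_add_INF_ennreal:
  fixes x k :: ennreal
  assumes le: "\<And>c. c \<in> C \<Longrightarrow> x \<le> k + f c"
  shows "x \<le> k + (INF c\<in>C. f c)"
proof (rule ennreal_le_epsilon)
  fix e :: real
  assume fin: "k + (INF c\<in>C. f c) < top" and e: "0 < e"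
  have "(INF c\<in>C. f c) + 0 < (INF c\<in>C. f c) + ennreal e"
    unfolding ennreal_add_left_cancel_less using e
    by (intro conjI) (metis fin ennreal_add_eq_top infinity_ennreal_def order_less_irrefl, simp)
  then obtain c where c: "c \<in> C" "f c < (INF c\<in>C. f c) + ennreal e"
    unfolding add_0_right INF_less_iff by blast
  have "x \<le> k + f c"
    by (rule le[OF c(1)])
  also have "\<dots> \<le> k + ((INF c\<in>C. f c) + ennreal e)"
    by (intro add_left_mono less_imp_le c(2))
  finally show "x \<le> k + (INF c\<in>C. f c) + ennreal e"
    by (simp add: add.assoc)
qed

lemma hausdorff_excess_triangle:
  "hausdorff_excess A C \<le> hausdorff_excess A B + hausdorff_excess B C"
  unfolding hausdorff_excess_def[of A C]
proof (rule SUP_least)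
  fix a assume a: "a \<in> A"
  have 1: "(INF c\<in>C. ennreal (sum_dist a c)) \<le> hausdorff_excess B C + ennreal (sum_dist a b)"
    if b: "b \<in> B" for b
  proof -
    have "(INF c\<in>C. ennreal (sum_dist a c))
        \<le> ennreal (sum_dist a b) + (INF c\<in>C. ennreal (sum_dist b c))"
    proof (rule le_add_INF_ennreal)
      fix c assume c: "c \<in> C"
      have "ennreal (sum_dist a c) \<le> ennreal (sum_dist a b + sum_dist b c)"
        by (intro ennreal_leI sum_dist_triangle)
      then show "(INF c\<in>C. ennreal (sum_dist a c))
          \<le> ennreal (sum_dist a b) + ennreal (sum_dist b c)"
        by (intro INF_lower2[OF c]) simp
    qed
    also have "\<dots> \<le> ennreal (sum_dist a b) + hausdorff_excess B C"
      unfolding hausdorff_excess_def by (intro add_left_mono SUP_upper b)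
    finally show ?thesis by (simp add: add.commute)
  qed
  have "(INF c\<in>C. ennreal (sum_dist a c))
      \<le> hausdorff_excess B C + (INF b\<in>B. ennreal (sum_dist a b))"
    by (rule le_add_INF_ennreal) (rule 1)
  also have "\<dots> \<le> hausdorff_excess B C + hausdorff_excess A B"
    unfolding hausdorff_excess_def[of A B] by (intro add_left_mono SUP_upper a)
  finally show "(INF c\<in>C. ennreal (sum_dist a c)) \<le> hausdorff_excess A B + hausdorff_excess B C"
    by (simp add: add.commute)
qed

lemma hausdorff_triangle: "hausdorff A C \<le> hausdorff A B + hausdorff B C"
proof -
  have "hausdorff_excess A C \<le> hausdorff A B + hausdorff B C"
    by (rule order_trans[OF hausdorff_excess_triangle[of A C B]])
      (auto simp: hausdorff_def intro!: add_mono)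
  moreover have "hausdorff_excess C A \<le> hausdorff B C + hausdorff A B"
    by (rule order_trans[OF hausdorff_excess_triangle[of C A B]])
      (auto simp: hausdorff_def intro!: add_mono)
  ultimately show ?thesis
    by (simp add: hausdorff_def[of A C] add.commute)
qed

lemma hausdorff_excess_endograph_le:
  assumes "fuzzy_set v"
  shows "hausdorff_excess (endograph u) (endograph v) \<le> 1"
  unfolding hausdorff_excess_def
proof (rule SUP_least)
  fix a assume "a \<in> endograph u"
  then obtain x t where a: "a = (x, t)" "0 \<le> t" "t \<le> 1"
    by (auto simp: endograph_def)
  have "(x, 0) \<in> endograph v"
    using assms by (auto simp: endograph_def fuzzy_set_def)
  then show "(INF b\<in>endograph v. ennreal (sum_dist a b)) \<le> 1"
    by (rule INF_lower2) (use a in \<open>simp add: sum_dist_def\<close>)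
qed

lemma hausdorff_endograph_le:
  "fuzzy_set u \<Longrightarrow> fuzzy_set v \<Longrightarrow> hausdorff (endograph u) (endograph v) \<le> 1"
  by (simp add: hausdorff_def hausdorff_excess_endograph_le)

lemma ennreal_H_end:
  assumes "fuzzy_set u" "fuzzy_set v"
  shows "ennreal (H_end u v) = hausdorff (endograph u) (endograph v)"
  unfolding H_end_def
  using hausdorff_endograph_le[OF assms]
  by (intro ennreal_enn2real) (metis ennreal_one_less_top order_le_less_trans)

lemma F_USC_le_if_excess_zero:
  assumes u: "fuzzy_set u" and v: "v \<in> F_USC"
    and 0: "hausdorff_excess (endograph u) (endograph v) = 0"
  shows "u x \<le> v x"
proof (rule ccontr)
  assume "\<not> u x \<le> v x"
  then obtain \<alpha> where \<alpha>: "v x < \<alpha>" "\<alpha> < u x"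
    using dense[of "v x" "u x"] by auto
  have "0 \<le> v x" "u x \<le> 1" "0 \<le> u x"
    using u v by (auto simp: F_USC_def fuzzy_set_def)
  then have "closed {y. v y \<ge> \<alpha>}"
    using v \<alpha> by (auto simp: F_USC_def level_def dest!: bspec[of _ _ \<alpha>])
  then have "open (- {y. v y \<ge> \<alpha>})" by (simp add: open_Compl)
  then obtain e where e: "e > 0" "\<And>y. dist y x < e \<Longrightarrow> v y < \<alpha>"
    using \<alpha> unfolding open_dist by force
  define \<delta> where "\<delta> = min e (u x - \<alpha>)"
  have \<delta>: "\<delta> > 0" using e \<alpha> by (simp add: \<delta>_def)
  have mem: "(x, u x) \<in> endograph u"
    using \<open>u x \<le> 1\<close> \<open>0 \<le> u x\<close> by (auto simp: endograph_def)
  have "(INF b\<in>endograph v. ennreal (sum_dist (x, u x) b)) \<le> 0"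
    using 0 SUP_upper[OF mem, of "\<lambda>a. INF b\<in>endograph v. ennreal (sum_dist a b)"]
    by (simp add: hausdorff_excess_def)
  then have "(INF b\<in>endograph v. ennreal (sum_dist (x, u x) b)) < ennreal \<delta>"
    using \<delta> by (simp add: ennreal_zero_less_divide)
  then obtain b where b: "b \<in> endograph v" "ennreal (sum_dist (x, u x) b) < ennreal \<delta>"
    unfolding INF_less_iff by blast
  obtain y t where yt: "b = (y, t)" "t \<le> v y"
    using b by (auto simp: endograph_def)
  have "dist x y + \<bar>u x - t\<bar> < \<delta>"
    using b(2)[unfolded ennreal_less_iff[OF sum_dist_nonneg]] yt by (simp add: sum_dist_def)
  moreover from this have "dist x y < \<delta>" "\<bar>u x - t\<bar> < \<delta>"
    using zero_le_dist[of x y] by linarith+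
  ultimately have "v y < \<alpha>" "t > \<alpha>"
    using e(2)[of y] by (auto simp: \<delta>_def dist_commute)
  then show False using yt by simp
qed

lemma Metric_space_F_USC: "Metric_space F_USC H_end"
proof
  fix u v w :: "'a \<Rightarrow> real"
  show "0 \<le> H_end u v" "H_end u v = H_end v u"
    by (simp_all add: H_end_def hausdorff_commute)
  assume u: "u \<in> F_USC" and v: "v \<in> F_USC"
  then have fuv: "fuzzy_set u" "fuzzy_set v" by (auto simp: F_USC_def)
  show "H_end u v = 0 \<longleftrightarrow> u = v"
  proof
    assume "H_end u v = 0"
    then have "hausdorff (endograph u) (endograph v) = 0"
      using ennreal_H_end[OF fuv] by simp
    then have "hausdorff_excess (endograph u) (endograph v) = 0"
      "hausdorff_excess (endograph v) (endograph u) = 0"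
      unfolding hausdorff_def by (metis max.bounded_iff le_zero_eq order_refl)+
    then show "u = v"
      using F_USC_le_if_excess_zero[OF fuv(1) v] F_USC_le_if_excess_zero[OF fuv(2) u]
      by (simp add: fun_eq_iff antisym)
  qed (simp add: H_end_def)
  assume w: "w \<in> F_USC"
  then have fw: "fuzzy_set w" by (auto simp: F_USC_def)
  have nonneg: "0 \<le> H_end f g" for f g :: "'a \<Rightarrow> real"
    by (simp add: H_end_def)
  have "ennreal (H_end u w) \<le> ennreal (H_end u v) + ennreal (H_end v w)"
    unfolding ennreal_H_end[OF fuv(1) fw] ennreal_H_end[OF fuv] ennreal_H_end[OF fuv(2) fw]
    by (rule hausdorff_triangle)
  also have "\<dots> = ennreal (H_end u v + H_end v w)"
    by (rule ennreal_plus[symmetric]) (rule nonneg)+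
  finally show "H_end u w \<le> H_end u v + H_end v w"
    by (rule ennreal_le_iff[THEN iffD1, rotated]) (intro add_nonneg_nonneg nonneg)
qed

lemma Metric_space_F_USCG: "Metric_space F_USCG H_end"
  by (rule Metric_space.subspace[OF Metric_space_F_USC]) (auto simp: F_USCG_def)

lemma Metric_space_F_USCG_max: "Metric_space (F_USCG_max r) H_end"
  by (rule Metric_space.subspace[OF Metric_space_F_USCG]) (auto simp: F_USCG_max_def)

abbreviation H_end_topology :: "('a::metric_space \<Rightarrow> real) set \<Rightarrow> ('a \<Rightarrow> real) topology" where
  "H_end_topology F \<equiv> Metric_space.mtopology F H_end"

end

theory Submission
  imports Defs
begin

text \<open>
  All six properties say that sequences in \<open>U\<close> have subsequences converging to members of \<open>U\<close>.

  From compactness of \<open>U\<close> to compactness of \<open>level_union U \<alpha>\<close>: points \<open>x\<^sub>n\<close> with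
  \<open>u\<^sub>n x\<^sub>n \<ge> \<alpha>\<close> lie, once \<open>u\<^sub>n\<close> converges to \<open>u\<close>, ever closer to points of the compact set
  \<open>{x. u x \<ge> \<alpha>/2}\<close>, so they cluster, and upper semicontinuity puts the cluster point into
  \<open>level u \<alpha>\<close> (\<open>compact_level_union\<close>).

  For the converse, let all \<open>level_union U \<alpha>\<close> be relatively compact. Up to an error \<open>e\<close>, an endograph
  is determined by which cells of a finite grid on \<open>level_union U e \<times> [0,1]\<close> it reaches, because
  heights below \<open>e\<close> are invisible at this precision; hence \<open>U\<close> is totally bounded
  (\<open>mtotally_bounded_if_level_unions\<close>), and every sequence in \<open>U\<close> has a Cauchy subsequence.
  The limit of a Cauchy sequence is built by hand as its upper hypo-limit \<open>hypo_limit\<close>, the fuzzy set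
  whose endograph consists of the cluster points of the endographs. That the endographs come
  close to it needs compactness of the level unions; that it comes close to the endographs
  needs the Cauchy property. Its maximum is \<open>r\<close> because the points where the maximum \<open>r\<close> is
  attained cluster as well. So the limit lies in \<open>F_USCG_max r\<close>, and closedness of \<open>U\<close> in that
  smaller space is enough to conclude.

  The remaining implications are monotone: compactness is intrinsic, compact sets are closed, and
  levels above \<open>r\<close> are empty.
\<close>

section \<open>The endograph metric in terms of heights\<close>

text \<open>A one-sided comparison up to the error \<open>e\<close>, which replaces the excess of one endograph over
  another: moving a point by less than \<open>e\<close> costs less than \<open>e\<close> in height. Heights up to \<open>e\<close> are
  exempt, since the bottom \<open>X \<times> {0}\<close> belongs to every endograph.\<close>

definition approx_below :: "real \<Rightarrow> ('a::metric_space \<Rightarrow> real) \<Rightarrow> ('a \<Rightarrow> real) \<Rightarrow> bool" where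
  "approx_below e u v \<longleftrightarrow> (\<forall>x. e < u x \<longrightarrow> (\<exists>y. dist x y < e \<and> u x - e < v y))"

lemma approx_below_if_H_end_less:
  assumes fuz: "fuzzy_set u" "fuzzy_set v" and less: "H_end u v < e"
  shows "approx_below e u v"
  unfolding approx_below_def
proof (intro allI impI)
  fix x assume "e < u x"
  have mem: "(x, u x) \<in> endograph u"
    using fuz by (auto simp: endograph_def fuzzy_set_def)
  have "0 \<le> H_end u v"
    by (simp add: H_end_def)
  then have "hausdorff (endograph u) (endograph v) < ennreal e"
    using less by (simp flip: ennreal_H_end[OF fuz] add: ennreal_less_iff)
  moreover have "(INF b\<in>endograph v. ennreal (sum_dist (x, u x) b))
      \<le> hausdorff (endograph u) (endograph v)"
    unfolding hausdorff_def hausdorff_excess_def by (intro max.coboundedI1 SUP_upper mem)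
  ultimately have "(INF b\<in>endograph v. ennreal (sum_dist (x, u x) b)) < ennreal e"
    by order
  then obtain b where b: "b \<in> endograph v" "ennreal (sum_dist (x, u x) b) < ennreal e"
    unfolding INF_less_iff by blast
  obtain y t where yt: "b = (y, t)" "t \<le> v y"
    using b(1) by (auto simp: endograph_def)
  have "dist x y + \<bar>u x - t\<bar> < e"
    using b(2)[unfolded ennreal_less_iff[OF sum_dist_nonneg]] yt by (simp add: sum_dist_def)
  then show "\<exists>y. dist x y < e \<and> u x - e < v y"
    using yt zero_le_dist[of x y] by (intro exI[of _ y]) linarith
qed

text \<open>The two coordinates contribute an error \<open>e\<close> each to the sum metric.\<close>

lemma hausdorff_excess_le_if_approx_below:
  assumes v: "fuzzy_set v" and e: "0 \<le> e" and below: "approx_below e u v"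
  shows "hausdorff_excess (endograph u) (endograph v) \<le> ennreal (2 * e)"
  unfolding hausdorff_excess_def
proof (rule SUP_least)
  fix a assume "a \<in> endograph u"
  then obtain x t where a: "a = (x, t)" "0 \<le> t" "t \<le> 1" "t \<le> u x"
    by (auto simp: endograph_def)
  have "\<exists>b\<in>endograph v. sum_dist a b \<le> 2 * e"
  proof (cases "t \<le> e")
    case True
    have "(x, 0) \<in> endograph v"
      using v by (auto simp: endograph_def fuzzy_set_def)
    then show ?thesis
      by (rule bexI[rotated]) (use a e True in \<open>simp add: sum_dist_def\<close>)
  next
    case False
    then obtain y where y: "dist x y < e" "u x - e < v y"
      using below a unfolding approx_below_def by force
    have "(y, t - e) \<in> endograph v"
      using y a e False by (auto simp: endograph_def)
    then show ?thesis
      by (rule bexI[rotated]) (use a e y in \<open>simp add: sum_dist_def\<close>)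
  qed
  then obtain b where "b \<in> endograph v" "sum_dist a b \<le> 2 * e"
    by blast
  then show "(INF b\<in>endograph v. ennreal (sum_dist a b)) \<le> ennreal (2 * e)"
    by (intro INF_lower2[of b]) (auto intro: ennreal_leI)
qed

lemma H_end_le_if_approx_below:
  assumes "fuzzy_set u" "fuzzy_set v" "0 \<le> e" "approx_below e u v" "approx_below e v u"
  shows "H_end u v \<le> 2 * e"
  unfolding H_end_def
  by (rule enn2real_leI)
    (use assms in \<open>auto simp: hausdorff_def intro: hausdorff_excess_le_if_approx_below\<close>)


section \<open>Level sets\<close>

lemma level_pos: "0 < \<alpha> \<Longrightarrow> level u \<alpha> = {x. \<alpha> \<le> u x}"
  by (simp add: level_def)

lemma fuzzy_set_if_F_USCG: "u \<in> F_USCG \<Longrightarrow> fuzzy_set u"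
  by (simp add: F_USCG_def F_USC_def)

lemma F_USCG_max_subset: "F_USCG_max r \<subseteq> F_USCG"
  by (auto simp: F_USCG_max_def)

lemma fuzzy_set_if_F_USCG_max: "u \<in> F_USCG_max r \<Longrightarrow> fuzzy_set u"
  using F_USCG_max_subset fuzzy_set_if_F_USCG by blast

lemma closed_superlevel:
  assumes "u \<in> F_USCG" "0 < \<alpha>" "\<alpha> \<le> 1"
  shows "closed {x. \<alpha> \<le> u x}"
  using assms by (auto simp: F_USCG_def F_USC_def level_pos dest!: bspec[of _ _ \<alpha>])

lemma compact_superlevel:
  assumes "u \<in> F_USCG" "0 < \<alpha>" "\<alpha> \<le> 1"
  shows "compact {x. \<alpha> \<le> u x}"
  using assms by (auto simp: F_USCG_def level_pos dest!: bspec[of _ _ \<alpha>])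

lemma F_USCG_I:
  assumes "fuzzy_set u" "\<And>\<alpha>. 0 < \<alpha> \<Longrightarrow> \<alpha> \<le> 1 \<Longrightarrow> compact {x. \<alpha> \<le> u x}"
  shows "u \<in> F_USCG"
proof -
  have "closed (level u \<alpha>)" if "\<alpha> \<in> {0..1}" for \<alpha>
    using that assms(2)[of \<alpha>] by (cases "\<alpha> = 0") (auto simp: level_def intro: compact_imp_closed)
  then show ?thesis
    using assms by (auto simp: F_USCG_def F_USC_def level_pos)
qed

lemma level_union_empty:
  assumes "U \<subseteq> F_USCG_max r" "0 < \<alpha>" "r < \<alpha>"
  shows "level_union U \<alpha> = {}"
proof -
  have "u x < \<alpha>" if "u \<in> U" for u x
    using assms that unfolding F_USCG_max_def by (blast intro: le_less_trans)
  then show ?thesis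
    using \<open>0 < \<alpha>\<close> by (auto simp: level_union_def level_pos not_le)
qed

lemma relatively_compact_if_compact:
  fixes S :: "'a::t2_space set"
  shows "compact S \<Longrightarrow> relatively_compact S"
  by (simp add: relatively_compact_def compact_imp_closed)


section \<open>Compact sets of fuzzy sets have compact level unions\<close>

text \<open>Points of membership at least \<open>\<alpha>\<close> in a convergent sequence of fuzzy sets are close to points of
  almost that membership in the limit, and these lie in a compact superlevel set of the limit.\<close>

theorem compact_level_union:
  fixes U :: "('a::metric_space \<Rightarrow> real) set"
  assumes U: "compactin (H_end_topology F_USCG) U" and \<alpha>: "0 < \<alpha>" "\<alpha> \<le> 1"
  shows "compact (level_union U \<alpha>)"
proof -
  interpret Metric_space "F_USCG :: ('a \<Rightarrow> real) set" H_end
    by (rule Metric_space_F_USCG)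
  have sub: "U \<subseteq> F_USCG"
    and seq: "\<forall>\<sigma> :: nat \<Rightarrow> 'a \<Rightarrow> real. range \<sigma> \<subseteq> U \<longrightarrow>
        (\<exists>l k. l \<in> U \<and> strict_mono k \<and> limitin mtopology (\<sigma> \<circ> k) l sequentially)"
    using compactin_sequentially[THEN iffD1, OF U] by simp_all
  have "\<exists>l\<in>level_union U \<alpha>. \<exists>k. strict_mono k \<and> (x \<circ> k) \<longlonglongrightarrow> l"
    if x: "\<forall>n. x n \<in> level_union U \<alpha>" for x :: "nat \<Rightarrow> 'a"
  proof -
    obtain s where s: "\<And>n. s n \<in> U" "\<And>n. \<alpha> \<le> s n (x n)"
      using x \<alpha> unfolding level_union_def by (simp add: level_pos) metis
    obtain u k where u: "u \<in> U" and k: "strict_mono k"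
      and lim: "limitin mtopology (s \<circ> k) u sequentially"
      using seq s(1) by (metis image_subsetI)
    have uG: "u \<in> F_USCG" using u sub by blast
    \<comment> \<open>The summand \<open>1 / Suc n\<close> makes the inequality \<open>H_end (s (k n)) u < \<delta> n\<close> strict.\<close>
    define \<delta> where "\<delta> n = H_end (s (k n)) u + 1 / Suc n" for n
    have "(\<lambda>n. H_end (s (k n)) u) \<longlonglongrightarrow> 0"
      using lim unfolding limitin_metric_dist_null by (simp add: o_def)
    then have \<delta>0: "\<delta> \<longlonglongrightarrow> 0"
      unfolding \<delta>_def by (intro tendsto_add_zero LIMSEQ_Suc lim_1_over_n)
    have near: "\<exists>y. dist (x (k n)) y < \<delta> n \<and> \<alpha> - \<delta> n < u y" if "\<delta> n < \<alpha>" for n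
    proof -
      have "H_end (s (k n)) u < \<delta> n"
        by (simp add: \<delta>_def)
      then have "approx_below (\<delta> n) (s (k n)) u"
        using s(1) sub uG by (intro approx_below_if_H_end_less fuzzy_set_if_F_USCG) auto
      moreover have "\<delta> n < s (k n) (x (k n))"
        using s(2)[of "k n"] that by linarith
      ultimately obtain y where "dist (x (k n)) y < \<delta> n" "s (k n) (x (k n)) - \<delta> n < u y"
        unfolding approx_below_def by blast
      then show ?thesis
        using s(2)[of "k n"] by (intro exI[of _ y]) auto
    qed
    obtain N where N: "\<And>n. N \<le> n \<Longrightarrow> \<delta> n < \<alpha> / 2"
      using order_tendstoD(2)[OF \<delta>0, of "\<alpha> / 2"] \<alpha> unfolding eventually_sequentially by auto
    have "\<exists>y. dist (x (k (n + N))) y < \<delta> (n + N) \<and> \<alpha> - \<delta> (n + N) < u y" for n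
      using N[of "n + N"] \<alpha> by (intro near) auto
    then obtain y where y: "\<And>n. dist (x (k (n + N))) (y n) < \<delta> (n + N)"
        "\<And>n. \<alpha> - \<delta> (n + N) < u (y n)"
      by metis
    \<comment> \<open>\<open>level u \<alpha>\<close> itself may miss all \<open>y n\<close>, so a lower level has to supply the cluster point.\<close>
    have "compact {x. \<alpha> / 2 \<le> u x}"
      using \<alpha> by (intro compact_superlevel[OF uG]) auto
    moreover have "\<forall>n. y n \<in> {x. \<alpha> / 2 \<le> u x}"
    proof
      show "y n \<in> {x. \<alpha> / 2 \<le> u x}" for n
        using y(2)[of n] N[of "n + N"] by simp
    qed
    ultimately obtain l m where m: "strict_mono m" and yl: "(y \<circ> m) \<longlonglongrightarrow> l"
      using compact_imp_seq_compact seq_compactE by blast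
    have \<delta>m: "(\<lambda>n. \<delta> (m n + N)) \<longlonglongrightarrow> 0"
      using LIMSEQ_subseq_LIMSEQ[OF LIMSEQ_ignore_initial_segment[OF \<delta>0, of N] m]
      by (simp add: o_def)
    \<comment> \<open>For every \<open>\<beta> < \<alpha>\<close>, almost all \<open>y n\<close> lie in the closed set \<open>{x. \<beta> \<le> u x}\<close>.\<close>
    have "\<alpha> \<le> u l"
    proof (rule dense_le_bounded[of 0])
      show "0 < \<alpha>" by fact
      fix \<beta> assume \<beta>: "0 < \<beta>" "\<beta> < \<alpha>"
      have "\<forall>\<^sub>F n in sequentially. \<delta> (m n + N) < \<alpha> - \<beta>"
        using order_tendstoD(2)[OF \<delta>m] \<beta> by simp
      then have "\<forall>\<^sub>F n in sequentially. (y \<circ> m) n \<in> {x. \<beta> \<le> u x}"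
      proof eventually_elim
        case (elim n)
        then show ?case
          using y(2)[of "m n"] by simp
      qed
      then have "l \<in> {x. \<beta> \<le> u x}"
        using closed_superlevel[OF uG, of \<beta>] \<beta> \<alpha> yl
        by (intro Lim_in_closed_set[of "{x. \<beta> \<le> u x}" "y \<circ> m" sequentially]) auto
      then show "\<beta> \<le> u l" by simp
    qed
    then have "l \<in> level_union U \<alpha>"
      using u \<alpha> by (auto simp: level_union_def level_pos)
    moreover have "strict_mono (\<lambda>n. k (m n + N))"
      using k m by (simp add: strict_mono_def)
    moreover have "(x \<circ> (\<lambda>n. k (m n + N))) \<longlonglongrightarrow> l"
      unfolding tendsto_dist_iff[of _ l]
    proof (rule tendsto_sandwich[OF _ _ tendsto_const])
      show "(\<lambda>n. \<delta> (m n + N) + dist ((y \<circ> m) n) l) \<longlonglongrightarrow> 0"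
        using \<delta>m yl by (intro tendsto_add_zero tendsto_dist_iff[THEN iffD1])
      show "\<forall>\<^sub>F n in sequentially. dist ((x \<circ> (\<lambda>n. k (m n + N))) n) l
          \<le> \<delta> (m n + N) + dist ((y \<circ> m) n) l"
      proof (rule always_eventually, rule)
        show "dist ((x \<circ> (\<lambda>n. k (m n + N))) n) l \<le> \<delta> (m n + N) + dist ((y \<circ> m) n) l" for n
          using y(1)[of "m n"] dist_triangle[of "x (k (m n + N))" l "y (m n)"] by simp
      qed
    qed (auto intro: always_eventually)
    ultimately show ?thesis
      by blast
  qed
  then show ?thesis
    unfolding compact_eq_seq_compact_metric seq_compact_def by blast
qed


section \<open>Cauchy sequences with relatively compact level unions converge\<close>

text \<open>The cluster points \<open>(x, t)\<close> of the endographs of a sequence. Lowering the height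
  down to 0 does not leave an endograph, so only a lower bound on the height is required.\<close>

definition cluster_height :: "(nat \<Rightarrow> 'a::metric_space \<Rightarrow> real) \<Rightarrow> 'a \<Rightarrow> real \<Rightarrow> bool" where
  "cluster_height s x t \<longleftrightarrow>
    (\<forall>e>0. \<exists>\<^sub>F n in sequentially. \<exists>y. dist x y < e \<and> t - e < s n y)"

text \<open>The upper hypo-limit, also known, up to sign, as the lower \<open>\<Gamma>\<close>-limit.\<close>

definition hypo_limit :: "(nat \<Rightarrow> 'a::metric_space \<Rightarrow> real) \<Rightarrow> 'a \<Rightarrow> real" where
  "hypo_limit s x = Sup {t \<in> {0..1}. cluster_height s x t}"

text \<open>The set of cluster points is closed, and passing to lower heights does not leave it: half of
  the tolerance pays for moving to a nearby cluster point, half for moving on to the sequence.\<close>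

lemma cluster_height_limit:
  assumes "\<And>e. 0 < e \<Longrightarrow> \<exists>x' t'. cluster_height s x' t' \<and> dist x x' < e \<and> t - e < t'"
  shows "cluster_height s x t"
  unfolding cluster_height_def
proof (intro allI impI)
  fix e :: real assume "0 < e"
  then obtain x' t' where *: "cluster_height s x' t'" "dist x x' < e / 2" "t - e / 2 < t'"
    using assms[of "e / 2"] by auto
  then have "\<exists>\<^sub>F n in sequentially. \<exists>y. dist x' y < e / 2 \<and> t' - e / 2 < s n y"
    using \<open>0 < e\<close> half_gt_zero unfolding cluster_height_def by blast
  then show "\<exists>\<^sub>F n in sequentially. \<exists>y. dist x y < e \<and> t - e < s n y"
  proof (rule frequently_elim1)
    fix n assume "\<exists>y. dist x' y < e / 2 \<and> t' - e / 2 < s n y"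
    then obtain y where "dist x' y < e / 2" "t' - e / 2 < s n y"
      by blast
    then show "\<exists>y. dist x y < e \<and> t - e < s n y"
      using * dist_triangle[of x y x'] by (intro exI[of _ y]) linarith
  qed
qed

context
  fixes s :: "nat \<Rightarrow> 'a::metric_space \<Rightarrow> real"
  assumes fuzzy: "\<And>n. fuzzy_set (s n)"
begin

lemma fuzzy_nonneg: "0 \<le> s n x"
  using fuzzy[of n] by (simp add: fuzzy_set_def)

lemma cluster_height_0: "cluster_height s x 0"
  unfolding cluster_height_def
proof (intro allI impI)
  fix e :: real assume "0 < e"
  then have "dist x x < e \<and> 0 - e < s n x" for n
    using fuzzy_nonneg[of n x] by simp
  then show "\<exists>\<^sub>F n in sequentially. \<exists>y. dist x y < e \<and> 0 - e < s n y"
    by (intro eventually_frequently always_eventually allI exI[of _ x]) auto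
qed

lemma hypo_limit_in: "hypo_limit s x \<in> {0..1}" (is ?in)
  and cluster_height_hypo_limit: "cluster_height s x (hypo_limit s x)" (is ?cluster)
proof -
  let ?T = "{t \<in> {0..1}. cluster_height s x t}"
  have ne: "0 \<in> ?T"
    using cluster_height_0 by auto
  have bdd: "bdd_above ?T"
    by (auto intro: bdd_aboveI[of _ 1])
  show ?in
    unfolding hypo_limit_def using ne bdd by (auto intro: cSup_upper cSup_least)
  show ?cluster
  proof (rule cluster_height_limit)
    fix e :: real assume "0 < e"
    then have "hypo_limit s x - e < Sup ?T"
      by (simp add: hypo_limit_def)
    then obtain t where "t \<in> ?T" "hypo_limit s x - e < t"
      using less_cSupE ne by (metis (no_types, lifting) empty_iff)
    then show "\<exists>x' t'. cluster_height s x' t' \<and> dist x x' < e \<and> hypo_limit s x - e < t'"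
      using \<open>0 < e\<close> by (intro exI[of _ x] exI[of _ t]) auto
  qed
qed

lemma fuzzy_set_hypo_limit: "fuzzy_set (hypo_limit s)"
  using hypo_limit_in by (simp add: fuzzy_set_def)

lemma hypo_limit_ge_iff:
  assumes "t \<in> {0..1}"
  shows "t \<le> hypo_limit s x \<longleftrightarrow> cluster_height s x t"
proof
  assume t: "t \<le> hypo_limit s x"
  show "cluster_height s x t"
  proof (rule cluster_height_limit)
    fix e :: real assume "0 < e"
    then show "\<exists>x' t'. cluster_height s x' t' \<and> dist x x' < e \<and> t - e < t'"
      using t cluster_height_hypo_limit by (intro exI[of _ x] exI[of _ "hypo_limit s x"]) auto
  qed
next
  assume "cluster_height s x t"
  then show "t \<le> hypo_limit s x"
    unfolding hypo_limit_def using assms by (intro cSup_upper) (auto intro: bdd_aboveI[of _ 1])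
qed

lemma hypo_limit_le:
  assumes "\<And>n x. s n x \<le> r"
  shows "hypo_limit s x \<le> r"
proof (rule field_le_epsilon)
  fix e :: real assume "0 < e"
  then have "\<exists>\<^sub>F n in sequentially. \<exists>y. dist x y < e \<and> hypo_limit s x - e < s n y"
    using cluster_height_hypo_limit unfolding cluster_height_def by blast
  then obtain n y where "hypo_limit s x - e < s n y"
    using frequently_ex by blast
  then show "hypo_limit s x \<le> r + e"
    using assms[of n y] by linarith
qed

text \<open>Cluster points of points of the endographs belong to the endograph of the limit.\<close>

lemma hypo_limit_ge_if_tendsto:
  assumes k: "strict_mono k" and x: "x \<longlonglongrightarrow> l" and t: "t \<longlonglongrightarrow> h"
    and le: "\<And>n. t n \<le> s (k n) (x n)" and h: "h \<in> {0..1}"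
  shows "h \<le> hypo_limit s l"
  unfolding hypo_limit_ge_iff[OF h] cluster_height_def
proof (intro allI impI)
  fix e :: real assume "0 < e"
  have "h - e < h"
    using \<open>0 < e\<close> by simp
  have ev: "\<forall>\<^sub>F n in sequentially. dist l (x n) < e \<and> h - e < s (k n) (x n)"
    using tendstoD[OF x \<open>0 < e\<close>] order_tendstoD(1)[OF t \<open>h - e < h\<close>]
  proof eventually_elim
    case (elim n)
    then show ?case
      using le[of n] by (simp add: dist_commute)
  qed
  show "\<exists>\<^sub>F n in sequentially. \<exists>y. dist l y < e \<and> h - e < s n y"
    unfolding frequently_sequentially
  proof
    fix N
    obtain n where "N \<le> n" "dist l (x n) < e \<and> h - e < s (k n) (x n)"
      using ev unfolding eventually_sequentially by (meson nle_le)
    then show "\<exists>n\<ge>N. \<exists>y. dist l y < e \<and> h - e < s n y"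
      using seq_suble[OF k, of n] by (intro exI[of _ "k n"]) (auto intro: order_trans)
  qed
qed

text \<open>A point of the endograph of the limit is close to the endograph of some late member of the
  sequence. By the Cauchy property all late members come equally close, uniformly in the point.\<close>

lemma hypo_limit_eventually_below:
  assumes cauchy: "\<And>n m. N \<le> n \<Longrightarrow> N \<le> m \<Longrightarrow> approx_below e (s n) (s m)" and "0 < e" "N \<le> m"
  shows "approx_below (2 * e) (hypo_limit s) (s m)"
  unfolding approx_below_def
proof (intro allI impI)
  fix x assume x: "2 * e < hypo_limit s x"
  have "\<exists>\<^sub>F n in sequentially. \<exists>y. dist x y < e \<and> hypo_limit s x - e < s n y"
    using cluster_height_hypo_limit \<open>0 < e\<close> unfolding cluster_height_def by blast
  then obtain n y where y: "N \<le> n" "dist x y < e" "hypo_limit s x - e < s n y"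
    unfolding frequently_sequentially by blast
  then obtain z where z: "dist y z < e" "s n y - e < s m z"
    using cauchy[OF y(1) \<open>N \<le> m\<close>] x unfolding approx_below_def by force
  show "\<exists>y. dist x y < 2 * e \<and> hypo_limit s x - 2 * e < s m y"
    using y z dist_triangle[of x z y] by (intro exI[of _ z]) linarith
qed

context
  assumes relcompact: "\<And>\<alpha>. 0 < \<alpha> \<Longrightarrow> relatively_compact (level_union (range s) \<alpha>)"
begin

text \<open>Points of the endographs at a positive height stay in the product of a compact set with the unit
  interval. This is how relative compactness of the level unions produces cluster points.\<close>

lemma clustering_points:
  fixes x :: "nat \<Rightarrow> 'a"
  assumes "0 < \<alpha>" and k: "strict_mono k" and ge: "\<And>n. \<alpha> \<le> s (k n) (x n)"
  obtains l h m where "strict_mono m" "(x \<circ> m) \<longlonglongrightarrow> l"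
    "(\<lambda>n. s (k (m n)) (x (m n))) \<longlonglongrightarrow> h" "h \<le> hypo_limit s l"
proof -
  let ?K = "closure (level_union (range s) \<alpha>) \<times> {0..1::real}"
  have "compact ?K"
    using relcompact[OF \<open>0 < \<alpha>\<close>] by (auto simp: relatively_compact_def intro: compact_Times)
  moreover have "(x n, s (k n) (x n)) \<in> ?K" for n
    using ge[of n] \<open>0 < \<alpha>\<close> fuzzy[of "k n"]
    by (auto simp: level_union_def level_pos fuzzy_set_def intro!: subsetD[OF closure_subset])
  ultimately obtain p m where p: "p \<in> ?K" and m: "strict_mono m"
    and lim: "((\<lambda>n. (x n, s (k n) (x n))) \<circ> m) \<longlonglongrightarrow> p"
    using seq_compactE[OF compact_imp_seq_compact, of ?K "\<lambda>n. (x n, s (k n) (x n))"] by blast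
  have x: "(x \<circ> m) \<longlonglongrightarrow> fst p" and h: "(\<lambda>n. s (k (m n)) (x (m n))) \<longlonglongrightarrow> snd p"
    using tendsto_fst[OF lim] tendsto_snd[OF lim] by (simp_all add: o_def)
  have "snd p \<le> hypo_limit s (fst p)"
    by (rule hypo_limit_ge_if_tendsto[OF strict_mono_o[OF k m] x h]) (use p in auto)
  then show ?thesis
    using that m x h by blast
qed

text \<open>Otherwise points of infinitely many endographs would keep their distance from the endograph of
  the limit, and yet cluster at one of its points.\<close>

lemma eventually_below_hypo_limit:
  assumes "0 < e"
  shows "\<forall>\<^sub>F n in sequentially. approx_below e (s n) (hypo_limit s)"
proof (rule ccontr)
  let ?u = "hypo_limit s"
  let ?I = "{n. \<not> approx_below e (s n) ?u}"
  assume "\<not> ?thesis"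
  then have "infinite ?I"
    unfolding not_eventually cofinite_eq_sequentially[symmetric] frequently_cofinite .
  then obtain k :: "nat \<Rightarrow> nat" where k: "strict_mono k" "\<And>n. k n \<in> ?I"
    using infinite_enumerate by blast
  then obtain x where x: "\<And>n. e < s (k n) (x n)"
      "\<And>n y. dist (x n) y < e \<Longrightarrow> \<not> s (k n) (x n) - e < ?u y"
    unfolding approx_below_def mem_Collect_eq by metis
  obtain l h m where "strict_mono m" and xl: "(x \<circ> m) \<longlonglongrightarrow> l"
    and sh: "(\<lambda>n. s (k (m n)) (x (m n))) \<longlonglongrightarrow> h" and h: "h \<le> ?u l"
    using clustering_points[OF \<open>0 < e\<close> k(1) less_imp_le[OF x(1)]] by blast
  have "\<forall>\<^sub>F n in sequentially. dist (x (m n)) l < e \<and> s (k (m n)) (x (m n)) < h + e"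
    using tendstoD[OF xl \<open>0 < e\<close>] order_tendstoD(2)[OF sh, of "h + e"] \<open>0 < e\<close>
    by (auto elim: eventually_elim2)
  then obtain n where "dist (x (m n)) l < e" "s (k (m n)) (x (m n)) < h + e"
    by (auto simp: eventually_sequentially)
  then show False
    using x(2) h by fastforce
qed

text \<open>A cluster point at height \<open>\<alpha>\<close> is a limit of points of membership above \<open>\<alpha> / 2\<close>, so
  the superlevel sets of the limit are closed subsets of compact sets.\<close>

lemma hypo_limit_in_F_USCG: "hypo_limit s \<in> F_USCG"
proof (rule F_USCG_I[OF fuzzy_set_hypo_limit])
  fix \<alpha> :: real assume \<alpha>: "0 < \<alpha>" "\<alpha> \<le> 1"
  then have lev: "{x. \<alpha> \<le> hypo_limit s x} = {x. cluster_height s x \<alpha>}"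
    by (simp add: hypo_limit_ge_iff)
  have "closed {x. cluster_height s x \<alpha>}"
    unfolding closure_subset_eq[symmetric]
  proof
    fix x assume x: "x \<in> closure {x. cluster_height s x \<alpha>}"
    have "cluster_height s x \<alpha>"
    proof (rule cluster_height_limit)
      fix e :: real assume "0 < e"
      then show "\<exists>x' t'. cluster_height s x' t' \<and> dist x x' < e \<and> \<alpha> - e < t'"
        using x unfolding closure_approachable by (force simp: dist_commute)
    qed
    then show "x \<in> {x. cluster_height s x \<alpha>}" by simp
  qed
  moreover have "{x. cluster_height s x \<alpha>} \<subseteq> closure (level_union (range s) (\<alpha> / 2))"
  proof
    fix x assume "x \<in> {x. cluster_height s x \<alpha>}"
    then have x: "cluster_height s x \<alpha>" by simp
    show "x \<in> closure (level_union (range s) (\<alpha> / 2))"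
      unfolding closure_approachable
    proof (intro allI impI)
      fix e :: real assume "0 < e"
      then have "0 < min e (\<alpha> / 2)"
        using \<alpha> by simp
      then have "\<exists>\<^sub>F n in sequentially. \<exists>y. dist x y < min e (\<alpha> / 2) \<and> \<alpha> - min e (\<alpha> / 2) < s n y"
        using x unfolding cluster_height_def by blast
      then obtain n y where "dist x y < min e (\<alpha> / 2)" "\<alpha> - min e (\<alpha> / 2) < s n y"
        using frequently_ex by blast
      then show "\<exists>y\<in>level_union (range s) (\<alpha> / 2). dist y x < e"
        using \<alpha> by (intro bexI[of _ y]) (auto simp: level_union_def level_pos dist_commute
          intro!: exI[of _ n])
    qed
  qed
  moreover have "compact (closure (level_union (range s) (\<alpha> / 2)))"
    using relcompact[of "\<alpha> / 2"] \<alpha> by (simp add: relatively_compact_def)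
  ultimately show "compact {x. \<alpha> \<le> hypo_limit s x}"
    unfolding lev using closed_Int_compact[of "{x. cluster_height s x \<alpha>}"]
    by (metis Int_absorb2)
qed

text \<open>If \<open>r > 0\<close>, the points where the members of the sequence attain \<open>r\<close> cluster at a point where the
  limit attains it; if \<open>r \<le> 0\<close>, every point has membership at least \<open>r\<close>.\<close>

lemma hypo_limit_in_F_USCG_max:
  assumes max: "\<And>n. s n \<in> F_USCG_max r"
  shows "hypo_limit s \<in> F_USCG_max r"
proof -
  have le: "hypo_limit s x \<le> r" for x
    using max by (intro hypo_limit_le) (auto simp: F_USCG_max_def)
  obtain x where x: "\<And>n. s n (x n) = r"
    using max unfolding F_USCG_max_def by (simp add: image_iff) metis
  have "\<exists>l. r \<le> hypo_limit s l"
  proof (cases "r \<le> 0")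
    case True
    then show ?thesis
      using fuzzy_set_hypo_limit by (auto simp: fuzzy_set_def intro: order_trans)
  next
    case False
    have "strict_mono id" "\<And>n. r \<le> s (id n) (x n)"
      using x by (simp_all add: strict_mono_id)
    then obtain l h m where "(\<lambda>n. s (id (m n)) (x (m n))) \<longlonglongrightarrow> h" "h \<le> hypo_limit s l"
      using clustering_points[of r id x] False by (metis not_le)
    then show ?thesis
      using x by (auto simp: LIMSEQ_const_iff)
  qed
  then show ?thesis
    using le hypo_limit_in_F_USCG by (auto simp: F_USCG_max_def intro: antisym)
qed

lemma H_end_hypo_limit_tendsto:
  assumes cauchy: "\<And>e. 0 < e \<Longrightarrow> \<exists>N. \<forall>n\<ge>N. \<forall>m\<ge>N. H_end (s n) (s m) < e"
  shows "(\<lambda>n. H_end (s n) (hypo_limit s)) \<longlonglongrightarrow> 0"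
proof (rule tendstoI)
  fix e :: real assume "0 < e"
  \<comment> \<open>Membership in \<open>s n\<close> and in the limit agrees up to \<open>2 * d\<close>, which bounds \<open>H_end\<close> by \<open>4 * d\<close>.\<close>
  define d where "d = e / 5"
  have d: "0 < d" using \<open>0 < e\<close> by (simp add: d_def)
  obtain N where N: "\<And>n m. N \<le> n \<Longrightarrow> N \<le> m \<Longrightarrow> H_end (s n) (s m) < d"
    using cauchy[OF d] by blast
  have "\<forall>\<^sub>F n in sequentially. approx_below (2 * d) (s n) (hypo_limit s)"
    using d by (intro eventually_below_hypo_limit) simp
  then show "\<forall>\<^sub>F n in sequentially. dist (H_end (s n) (hypo_limit s)) 0 < e"
    using eventually_ge_at_top[of N]
  proof eventually_elim
    case (elim n)
    have "approx_below (2 * d) (hypo_limit s) (s n)"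
      using d elim(2)
      by (intro hypo_limit_eventually_below[of N] approx_below_if_H_end_less fuzzy N)
    then have "H_end (s n) (hypo_limit s) \<le> 2 * (2 * d)"
      using elim(1) d by (intro H_end_le_if_approx_below fuzzy fuzzy_set_hypo_limit) auto
    also have "\<dots> < e"
      using \<open>0 < e\<close> by (simp add: d_def)
    finally show ?case
      by (simp add: H_end_def)
  qed
qed

end

end


section \<open>Total boundedness\<close>

text \<open>Two members of \<open>U\<close> that reach the same cells of a grid with ball-shaped cells of radius \<open>e\<close> around
  the centres \<open>C\<close> and height step \<open>e\<close> are within \<open>4 * e\<close> of each other. As there are finitely many
  sets of cells, choosing one member of \<open>U\<close> for each set of cells gives a finite net.\<close>

lemma finite_net_if_level_unions:
  fixes U :: "('a::metric_space \<Rightarrow> real) set"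
  assumes fuzzy: "\<And>u. u \<in> U \<Longrightarrow> fuzzy_set u"
    and relcompact: "relatively_compact (level_union U e)" and e: "0 < e"
  obtains F where "finite F" "F \<subseteq> U" "\<And>u. u \<in> U \<Longrightarrow> \<exists>v\<in>F. H_end v u \<le> 4 * e"
proof -
  obtain C where C: "finite C" "closure (level_union U e) \<subseteq> (\<Union>c\<in>C. ball c e)"
    using seq_compact_imp_totally_bounded[OF compact_imp_seq_compact,
        OF relcompact[unfolded relatively_compact_def]] e
    by meson
  \<comment> \<open>Memberships are at most 1, so a height \<open>j * e\<close> with \<open>j > 1 / e\<close> is never reached.\<close>
  define J where "J = {..nat \<lfloor>1 / e\<rfloor>}"
  define cells where "cells u = {(c, j) \<in> C \<times> J. \<exists>y\<in>ball c e. real j * e \<le> u y}"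
    for u :: "'a \<Rightarrow> real"
  have below: "approx_below (2 * e) u v"
    if u: "u \<in> U" and eq: "cells u = cells v" for u v
    unfolding approx_below_def
  proof (intro allI impI)
    fix x assume x: "2 * e < u x"
    have ux: "0 \<le> u x" "u x \<le> 1"
      using fuzzy[OF u] by (auto simp: fuzzy_set_def)
    have "x \<in> level_union U e"
      using x e u by (auto simp: level_union_def level_pos intro!: bexI[of _ u])
    then obtain c where c: "c \<in> C" "x \<in> ball c e"
      using C(2) closure_subset by blast
    define j where "j = nat \<lfloor>u x / e\<rfloor>"
    have j: "real j \<le> u x / e" "u x / e < real j + 1"
      using ux e by (auto simp: j_def)
    have "j \<in> J"
      using ux e by (auto simp: j_def J_def intro!: nat_mono floor_mono divide_right_mono)
    moreover have "real j * e \<le> u x"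
      using j(1) e by (simp add: field_simps)
    ultimately have "(c, j) \<in> cells u"
      using c unfolding cells_def by blast
    then have "(c, j) \<in> cells v"
      by (simp only: eq)
    then obtain y where y: "y \<in> ball c e" "real j * e \<le> v y"
      by (auto simp: cells_def)
    have "u x - e < real j * e"
      using j(2) e by (simp add: field_simps)
    then show "\<exists>y. dist x y < 2 * e \<and> u x - 2 * e < v y"
      using y c dist_triangle3[of x y c] e by (intro exI[of _ y]) auto
  qed
  have "cells ` U \<subseteq> Pow (C \<times> J)"
    by (auto simp: cells_def)
  then have fin: "finite (cells ` U)"
    by (rule finite_subset) (use C(1) in \<open>simp add: J_def\<close>)
  show ?thesis
  proof
    show "finite (inv_into U cells ` cells ` U)"
      using fin by blast
    show "inv_into U cells ` cells ` U \<subseteq> U"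
      by (auto intro: inv_into_into)
    fix u assume u: "u \<in> U"
    define v where "v = inv_into U cells (cells u)"
    have v: "v \<in> U" "cells v = cells u"
      using u unfolding v_def by (simp_all add: inv_into_into f_inv_into_f)
    have "H_end v u \<le> 2 * (2 * e)"
      using u v(1) e by (intro H_end_le_if_approx_below fuzzy below[OF v] below[OF u v(2)[symmetric]]) auto
    then show "\<exists>v\<in>inv_into U cells ` cells ` U. H_end v u \<le> 4 * e"
      using u by (auto simp: v_def)
  qed
qed

lemma mtotally_bounded_if_level_unions:
  assumes U: "U \<subseteq> F_USCG_max r"
    and relcompact: "\<And>\<alpha>. 0 < \<alpha> \<Longrightarrow> relatively_compact (level_union U \<alpha>)"
  shows "Metric_space.mtotally_bounded (F_USCG_max r) H_end U"
proof -
  interpret Metric_space "F_USCG_max r" H_end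
    by (rule Metric_space_F_USCG_max)
  show ?thesis
    unfolding mtotally_bounded_def
  proof (intro allI impI)
    fix e :: real assume "0 < e"
    then obtain F where F: "finite F" "F \<subseteq> U" "\<And>u. u \<in> U \<Longrightarrow> \<exists>v\<in>F. H_end v u \<le> 4 * (e / 5)"
      using finite_net_if_level_unions[of U "e / 5"] relcompact[of "e / 5"] U
        fuzzy_set_if_F_USCG_max by (metis divide_pos_pos subsetD zero_less_numeral)
    have "U \<subseteq> (\<Union>v\<in>F. mball v e)"
    proof
      fix u assume u: "u \<in> U"
      then obtain v where "v \<in> F" "H_end v u \<le> 4 * (e / 5)"
        using F(3) by blast
      then show "u \<in> (\<Union>v\<in>F. mball v e)"
        using u F(2) U \<open>0 < e\<close> by (auto simp: in_mball intro!: bexI[of _ v])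
    qed
    with F show "\<exists>K. finite K \<and> K \<subseteq> U \<and> U \<subseteq> (\<Union>x\<in>K. mball x e)"
      by blast
  qed
qed

text \<open>Closedness in the small space suffices because the hypo-limit is again a member of it.\<close>

theorem compactin_if_level_unions:
  fixes U :: "('a::metric_space \<Rightarrow> real) set"
  assumes relcompact: "\<And>\<alpha>. 0 < \<alpha> \<Longrightarrow> relatively_compact (level_union U \<alpha>)"
    and closed: "closedin (H_end_topology (F_USCG_max r)) U"
  shows "compactin (H_end_topology (F_USCG_max r)) U"
proof -
  interpret Metric_space "F_USCG_max r :: ('a \<Rightarrow> real) set" H_end
    by (rule Metric_space_F_USCG_max)
  have U: "U \<subseteq> F_USCG_max r"
    using closedin_subset[OF closed] by simp
  have "\<exists>l k. l \<in> U \<and> strict_mono k \<and> limitin mtopology (\<sigma> \<circ> k) l sequentially"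
    if \<sigma>: "range \<sigma> \<subseteq> U" for \<sigma> :: "nat \<Rightarrow> 'a \<Rightarrow> real"
  proof -
    obtain k where k: "strict_mono k" and "MCauchy (\<sigma> \<circ> k)"
      using mtotally_bounded_if_level_unions[OF U relcompact] \<sigma>
      unfolding mtotally_bounded_sequentially by blast
    define s where "s = \<sigma> \<circ> k"
    have sU: "range s \<subseteq> U"
      using \<sigma> by (auto simp: s_def)
    have rel: "relatively_compact (level_union (range s) \<alpha>)" if "0 < \<alpha>" for \<alpha>
    proof -
      have "closure (level_union (range s) \<alpha>) \<subseteq> closure (level_union U \<alpha>)"
        using sU by (intro closure_mono) (auto simp: level_union_def)
      then show ?thesis
        using relcompact[OF that] unfolding relatively_compact_def
        by (metis closed_closure closed_Int_compact Int_absorb2)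
    qed
    have mem: "s n \<in> F_USCG_max r" for n
      using sU U by blast
    have fuz: "fuzzy_set (s n)" for n
      using mem by (rule fuzzy_set_if_F_USCG_max)
    have lim: "hypo_limit s \<in> F_USCG_max r"
      by (rule hypo_limit_in_F_USCG_max[OF fuz rel mem])
    moreover have "(\<lambda>n. H_end (s n) (hypo_limit s)) \<longlonglongrightarrow> 0"
    proof (rule H_end_hypo_limit_tendsto[OF fuz rel])
      fix e :: real assume "0 < e"
      then obtain N where "\<forall>n m. N \<le> n \<longrightarrow> N \<le> m \<longrightarrow> H_end (s n) (s m) < e"
        using \<open>MCauchy (\<sigma> \<circ> k)\<close> unfolding s_def[symmetric] MCauchy_def by meson
      then show "\<exists>N. \<forall>n\<ge>N. \<forall>m\<ge>N. H_end (s n) (s m) < e"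
        by (intro exI[of _ N] allI impI) simp
    qed
    ultimately have conv: "limitin mtopology s (hypo_limit s) sequentially"
      by (simp add: limitin_metric_dist_null mem)
    then have "hypo_limit s \<in> U"
      using closed sU unfolding metric_closedin_iff_sequentially_closed by blast
    with k conv show ?thesis
      unfolding s_def by blast
  qed
  then show ?thesis
    unfolding compactin_sequentially using U by blast
qed


section \<open>The characterizations\<close>

lemma H_end_topology_F_USCG_max:
  "H_end_topology (F_USCG_max r) = subtopology (H_end_topology F_USCG) (F_USCG_max r)"
proof -
  interpret Submetric "F_USCG :: ('a \<Rightarrow> real) set" H_end "F_USCG_max r"
    by (intro Submetric.intro Metric_space_F_USCG Submetric_axioms.intro F_USCG_max_subset)
  show ?thesis by (rule mtopology_submetric)
qed

theorem corollary6p12: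
  fixes r :: real and U :: "('a::metric_space \<Rightarrow> real) set"
  assumes "r \<in> {0..1}" and "U \<subseteq> F_USCG_max r"
  shows
    "(compactin (H_end_topology F_USCG) U \<longleftrightarrow>
        compactin (H_end_topology (F_USCG_max r)) U) \<and>
     (compactin (H_end_topology F_USCG) U \<longleftrightarrow>
        (\<forall>\<alpha>\<in>{0<..1}. relatively_compact (level_union U \<alpha>)) \<and>
        closedin (H_end_topology F_USCG) U) \<and>
     (compactin (H_end_topology F_USCG) U \<longleftrightarrow>
        (\<forall>\<alpha>\<in>{0<..1}. compact (level_union U \<alpha>)) \<and>
        closedin (H_end_topology F_USCG) U) \<and>
     (compactin (H_end_topology F_USCG) U \<longleftrightarrow>
        (\<forall>\<alpha>\<in>{0<..r}. relatively_compact (level_union U \<alpha>)) \<and>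
        closedin (H_end_topology (F_USCG_max r)) U) \<and>
     (compactin (H_end_topology F_USCG) U \<longleftrightarrow>
        (\<forall>\<alpha>\<in>{0<..r}. compact (level_union U \<alpha>)) \<and>
        closedin (H_end_topology (F_USCG_max r)) U)"
proof -
  let ?i = "compactin (H_end_topology F_USCG) U"
  let ?ii = "compactin (H_end_topology (F_USCG_max r)) U"
  let ?closed = "closedin (H_end_topology F_USCG) U"
  let ?closed_max = "closedin (H_end_topology (F_USCG_max r)) U"
  interpret Metric_space "F_USCG :: ('a \<Rightarrow> real) set" H_end
    by (rule Metric_space_F_USCG)
  have ii_iff: "?i \<longleftrightarrow> ?ii"
    using assms(2) by (simp add: H_end_topology_F_USCG_max compactin_subtopology)
  have closed: "?closed" if "?i"
    using that by (rule compactin_imp_closedin[OF Hausdorff_space_mtopology])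
  have closed_max: "?closed_max" if "?closed"
    using that assms(2) unfolding H_end_topology_F_USCG_max
    by (auto simp: closedin_subtopology)
  have lev: "compact (level_union U \<alpha>)" if "?i" "\<alpha> \<in> {0<..1}" for \<alpha>
    using that by (intro compact_level_union) auto
  \<comment> \<open>Relative compactness up to height \<open>r\<close> and closedness in the small space are the weakest
    hypotheses, so the other implications to compactness follow.\<close>
  have converse: "?i"
    if rel: "\<forall>\<alpha>\<in>{0<..r}. relatively_compact (level_union U \<alpha>)" and cl: "?closed_max"
  proof -
    have "relatively_compact (level_union U \<alpha>)" if "0 < \<alpha>" for \<alpha>
      using rel that level_union_empty[OF assms(2), of \<alpha>]
      by (cases "\<alpha> \<le> r") (auto simp: relatively_compact_def)
    then show ?thesis
      unfolding ii_iff using cl by (rule compactin_if_level_unions)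
  qed
  have sub: "{0<..r} \<subseteq> {0<..1}"
    using assms(1) by auto
  show ?thesis
    using ii_iff closed closed_max lev converse relatively_compact_if_compact sub
    by (intro conjI iffI) blast+
qed

end
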